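(* Let $\mathcal{U}_T$ be a finite set of message events and, for $\mathcal{H}_T\subseteq\mathcal{U}_T$, let $\boldsymbol{\Sigma}(\mathcal{H}_T)$ be the estimation covariance matrix defined in the context. Define the set functions on subsets of $\mathcal{U}_T$ $$f_A(\mathcal{H}_T)=-\operatorname{tr}\big[\boldsymbol{\Sigma}(\mathcal{H}_T)\big],\quad f_D(\mathcal{H}_T)=-\log\det\big[\boldsymbol{\Sigma}(\mathcal{H}_T)\big],\quad f_E(\mathcal{H}_T)=-\lambda_{\max}\big[\boldsymbol{\Sigma}(\mathcal{H}_T)\big],\quad f_T(\mathcal{H}_T)=\operatorname{tr}\big[\boldsymbol{\Sigma}(\mathcal{H}_T)^{-1}\big].$$ Then: (1) $f_X(\mathcal{H}_T)$ is monotone in $\mathcal{H}_T$ for every $X\in\{A,D,E,T\}$, i.e. $f_X(\mathcal{H}_T\cup\{e\})\ge f_X(\mathcal{H}_T)$ for all $\mathcal{H}_T\subseteq\mathcal{U}_T$ and $e\in\mathcal{U}_T$; (2) $f_A(\mathcal{H}_T)$ and $f_E(\mathcal{H}_T)$ are weakly submodular in $\mathcal{H}_T$; (3) $f_D(\mathcal{H}_T)$ is submodular in $\mathcal{H}_T$; (4) $f_T(\mathcal{H}_T)$ is modular in $\mathcal{H}_T$.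
   Context: Setting. $\mathcal{V}$ is a finite set of users. $\mathcal{U}_T=\{e_i=(u_i,\zeta_i,t_i)\}$ is a finite set of message events, where $u_i\in\mathcal{V}$ is the posting user, $\zeta_i\in\mathbb{R}$ is the sentiment value and $t_i\in[0,T)$ is the posting time. Fix constants $c>0$ (regularization), $\sigma>0$ (noise level), $\omega\ge 0$, and let $g(t)=e^{-\omega t}$. Feature vectors. For $u\in\mathcal{V}$ and $e_i\in\mathcal{U}_T$, define $\boldsymbol{\phi}^u_i\in\mathbb{R}^{|\mathcal{V}|+1}$ as follows. If $u_i=u$, then $\boldsymbol{\phi}^u_i$ has, for each $v\in\mathcal{V}$, the coordinate $\sum_{e_j\in\mathcal{U}_T:\,u_j=v,\,t_j<t_i}\zeta_j\,g(t_i-t_j)$, and its last coordinate is $1$. If $u_i\ne u$, then $\boldsymbol{\phi}^u_i=0$. (The features are computed from the whole set $\mathcal{U}_T$, not only from $\mathcal{H}_T$.) Covariance. $\boldsymbol{\Sigma}(\mathcal{H}_T)$ is the block-diagonal matrix with one block per user $u\in\mathcal{V}$, the block of $u$ being $\big(c\mathbf{I}+\sigma^{-2}\sum_{e_i\in\mathcal{H}_T}\boldsymbol{\phi}^u_i(\boldsymbol{\phi}^u_i)^{\top}\big)^{-1}$. $\lambda_{\max}$ denotes the largest eigenvalue. Properties of a set function $h$ on subsets of a set $U$: - $h$ is submodular if for all $V\subseteq\bar V\subseteq U$ and $x\in U\setminus\bar V$, $h(V\cup\{x\})-h(V)\ge h(\bar V\cup\{x\})-h(\bar V)$. - $h$ is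 modular if, in addition, there are a constant $w(\emptyset)$ and a weight function $w:U\to\mathbb{R}$ with $h(V)=w(\emptyset)+\sum_{x\in V}w(x)$ for all $V\subseteq U$. - $h$ is weakly submodular if the two quantities $$c_h=\max_{V\subseteq\bar V,\;x\notin\bar V}\frac{h(\bar V\cup\{x\})-h(\bar V)}{h(V\cup\{x\})-h(V)},\qquad \epsilon_h=\max_{V\subseteq\bar V,\;x\notin\bar V}\Big[\big(h(\bar V\cup\{x\})-h(\bar V)\big)-\big(h(V\cup\{x\})-h(V)\big)\Big]$$ are bounded; they are called the multiplicative and additive weak submodularity constants.
   Formalization: In the multiplicative weak submodularity constant, quotients with zero denominator are left out, since for f_E a gain can vanish at V and be positive at a larger set; for f_A it is proved that no denominator vanishes. *)

theory Defs
  imports "HOL-Analysis.Analysis"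
begin

section \<open>Set functions\<close>

definition gain :: "('a set \<Rightarrow> real) \<Rightarrow> 'a set \<Rightarrow> 'a \<Rightarrow> real" where
  "gain h V x = h (V \<union> {x}) - h V"

definition monotone_set_fun :: "('a set \<Rightarrow> real) \<Rightarrow> 'a set \<Rightarrow> bool" where
  "monotone_set_fun h U \<longleftrightarrow> (\<forall>V x. V \<subseteq> U \<and> x \<in> U \<longrightarrow> h (V \<union> {x}) \<ge> h V)"

definition submodular :: "('a set \<Rightarrow> real) \<Rightarrow> 'a set \<Rightarrow> bool" where
  "submodular h U \<longleftrightarrow>
     (\<forall>V W x. V \<subseteq> W \<and> W \<subseteq> U \<and> x \<in> U - W \<longrightarrow> gain h V x \<ge> gain h W x)"

definition modular :: "('a set \<Rightarrow> real) \<Rightarrow> 'a set \<Rightarrow> bool" where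
  "modular h U \<longleftrightarrow> submodular h U \<and>
     (\<exists>(w0::real) (w::'a \<Rightarrow> real). \<forall>V. V \<subseteq> U \<longrightarrow> h V = w0 + (\<Sum>x\<in>V. w x))"

(* The maxima are taken as suprema in ereal, so that being bounded is a property
   of the constants. A quotient contributes to the multiplicative constant only
   if its denominator is nonzero: division by zero must neither count as 0
   (the HOL convention) nor be forbidden, since a gain of the largest-eigenvalue
   criterion can vanish at V and be positive at a superset W. *)

definition mult_weak_const :: "('a set \<Rightarrow> real) \<Rightarrow> 'a set \<Rightarrow> ereal" where
  "mult_weak_const h U =
     Sup {ereal (gain h W x / gain h V x) | V W x.
            V \<subseteq> W \<and> W \<subseteq> U \<and> x \<in> U - W \<and> gain h V x \<noteq> 0}"

definition add_weak_const :: "('a set \<Rightarrow> real) \<Rightarrow> 'a set \<Rightarrow> ereal" where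
  "add_weak_const h U =
     Sup {ereal (gain h W x - gain h V x) | V W x.
            V \<subseteq> W \<and> W \<subseteq> U \<and> x \<in> U - W}"

definition weakly_submodular :: "('a set \<Rightarrow> real) \<Rightarrow> 'a set \<Rightarrow> bool" where
  "weakly_submodular h U \<longleftrightarrow> mult_weak_const h U < \<infinity> \<and> add_weak_const h U < \<infinity>"


section \<open>Matrices\<close>

definition eigenvalue :: "real^'n^'n \<Rightarrow> real \<Rightarrow> bool" where
  "eigenvalue A l \<longleftrightarrow> (\<exists>x. x \<noteq> 0 \<and> A *v x = l *\<^sub>R x)"

definition lambda_max :: "real^'n^'n \<Rightarrow> real" where
  "lambda_max A = (GREATEST l. eigenvalue A l)"

definition outer :: "real^'n \<Rightarrow> real^'m \<Rightarrow> real^'m^'n" where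
  "outer x y = (\<chi> i j. x $ i * y $ j)"

definition block_diag :: "('u \<Rightarrow> real^'n^'n) \<Rightarrow> real^('u::finite \<times> 'n)^('u \<times> 'n)" where
  "block_diag B = (\<chi> p q. if fst p = fst q then B (fst p) $ snd p $ snd q else 0)"


section \<open>Message events and the estimation covariance\<close>

datatype 'v event = Event (user: 'v) (sentiment: real) (time: real)

definition kernel :: "real \<Rightarrow> real \<Rightarrow> real" where
  "kernel \<omega> t = exp (- \<omega> * t)"

(* Coordinates are indexed by the type 'v option: Some v is the coordinate of
   the user v and None is the last one. The type 'v is the set of all users. *)

definition feature :: "real \<Rightarrow> 'v event set \<Rightarrow> 'v \<Rightarrow> 'v event \<Rightarrow> real^('v::finite option)" where
  "feature \<omega> UT u e =
     (if user e = u
      then \<chi> k. case k of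
             Some v \<Rightarrow> \<Sum>e'\<in>{e' \<in> UT. user e' = v \<and> time e' < time e}.
                          sentiment e' * kernel \<omega> (time e - time e')
           | None \<Rightarrow> 1
      else 0)"

definition cov_block ::
  "real \<Rightarrow> real \<Rightarrow> real \<Rightarrow> 'v event set \<Rightarrow> 'v event set \<Rightarrow> 'v
     \<Rightarrow> real^('v::finite option)^('v option)" where
  "cov_block c \<sigma> \<omega> UT H u =
     matrix_inv (c *\<^sub>R mat 1 + (1 / \<sigma>\<^sup>2) *\<^sub>R
       (\<Sum>e\<in>H. outer (feature \<omega> UT u e) (feature \<omega> UT u e)))"

definition Cov ::
  "real \<Rightarrow> real \<Rightarrow> real \<Rightarrow> 'v event set \<Rightarrow> 'v event set
     \<Rightarrow> real^('v::finite \<times> 'v option)^('v \<times> 'v option)" where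
  "Cov c \<sigma> \<omega> UT H = block_diag (cov_block c \<sigma> \<omega> UT H)"

definition f_A :: "real \<Rightarrow> real \<Rightarrow> real \<Rightarrow> ('v::finite) event set \<Rightarrow> 'v event set \<Rightarrow> real" where
  "f_A c \<sigma> \<omega> UT H = - trace (Cov c \<sigma> \<omega> UT H)"

definition f_D :: "real \<Rightarrow> real \<Rightarrow> real \<Rightarrow> ('v::finite) event set \<Rightarrow> 'v event set \<Rightarrow> real" where
  "f_D c \<sigma> \<omega> UT H = - ln (det (Cov c \<sigma> \<omega> UT H))"

definition f_E :: "real \<Rightarrow> real \<Rightarrow> real \<Rightarrow> ('v::finite) event set \<Rightarrow> 'v event set \<Rightarrow> real" where
  "f_E c \<sigma> \<omega> UT H = - lambda_max (Cov c \<sigma> \<omega> UT H)"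

definition f_T :: "real \<Rightarrow> real \<Rightarrow> real \<Rightarrow> ('v::finite) event set \<Rightarrow> 'v event set \<Rightarrow> real" where
  "f_T c \<sigma> \<omega> UT H = trace (matrix_inv (Cov c \<sigma> \<omega> UT H))"

end

theory Submission
  imports Defs
begin

text \<open>Stacking the blocks, the covariance of \<open>H\<close> is the inverse of the single matrix
  \<open>M H = c I + \<Sum>e\<in>H. q e (q e)\<^sup>T\<close> with nonzero vectors \<open>q e\<close>, so adding an event is a rank-one
  update. The Sherman--Morrison formula shows that the update strictly decreases the trace of the
  inverse and decreases its quadratic form, hence also its largest eigenvalue. The matrix
  determinant lemma gives the gain of the log-determinant as
  \<open>ln (1 + q x \<bullet> (M V)\<inverse> q x)\<close>, which decreases in \<open>V\<close>. The trace of \<open>M H\<close> is additive.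
  Weak submodularity only asks for finite constants, which is automatic on a finite ground
  set.\<close>

section \<open>Rank-one matrices and inverses\<close>

lemma outer_mult_vec: "outer x y *v z = (y \<bullet> z) *\<^sub>R x"
  by (simp add: vec_eq_iff outer_def matrix_vector_mult_def inner_vec_def sum_distrib_left
      algebra_simps)

lemma transpose_outer: "transpose (outer x y) = outer y x"
  by (simp add: vec_eq_iff outer_def transpose_def)

lemma outer_scaleR: "outer (a *\<^sub>R x) (b *\<^sub>R y) = (a * b) *\<^sub>R outer x y"
  by (simp add: vec_eq_iff outer_def)

lemma outer_zero_right [simp]: "outer x 0 = 0"
  by (simp add: vec_eq_iff outer_def)

lemma matrix_mult_outer: "A ** outer x y = outer (A *v x) y"
  by (simp add: vec_eq_iff outer_def matrix_matrix_mult_def matrix_vector_mult_def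
      sum_distrib_right mult.assoc)

lemma outer_mult_matrix: "outer x y ** A = outer x (transpose A *v y)"
  by (simp add: vec_eq_iff outer_def matrix_matrix_mult_def vector_matrix_mult_def
      sum_distrib_left algebra_simps)

lemma matrix_add_rdistrib:
  fixes A B :: "real^'n^'m" and C :: "real^'k^'n"
  shows "(A + B) ** C = A ** C + B ** C"
  by (simp add: vec_eq_iff matrix_matrix_mult_def sum.distrib algebra_simps)

lemma trace_outer: "trace (outer x x) = x \<bullet> x"
  by (simp add: trace_def outer_def inner_vec_def)

lemma trace_scaleR: "trace (k *\<^sub>R (A :: real^'n^'n)) = k * trace A"
  by (simp add: trace_def sum_distrib_left)

text \<open>\<open>matrix_inv\<close> chooses some two-sided inverse. For square matrices a right
  inverse is already two-sided, and inverses are unique.\<close>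

lemma matrix_inv_eqI:
  fixes A B :: "real^'n^'n"
  assumes "A ** B = mat 1"
  shows "matrix_inv A = B"
proof -
  have "invertible A"
    using assms invertible_right_inverse by blast
  then have "A ** matrix_inv A = mat 1 \<and> matrix_inv A ** A = mat 1"
    unfolding invertible_def matrix_inv_def by (rule someI_ex)
  then show ?thesis
    by (metis assms matrix_mul_assoc matrix_mul_lid matrix_mul_rid)
qed

text \<open>The rank-one term changes only column \<open>k\<close> of the identity, replacing it by
  \<open>axis k 1 + u\<close>. Cramer's rule for the identity matrix then reads off coordinate
  \<open>k\<close> of that column.\<close>

lemma det_identity_add_outer_axis:
  fixes u :: "real^'n"
  shows "det (mat 1 + outer u (axis k 1)) = 1 + u $ k"
proof -
  have "mat 1 + outer u (axis k 1) =
      (\<chi> i j. if j = k then (mat 1 *v (axis k 1 + u)) $ i else mat 1 $ i $ j)"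
    unfolding matrix_vector_mul_lid by (auto simp: vec_eq_iff outer_def axis_def mat_def)
  then have "det (mat 1 + outer u (axis k 1)) = (axis k 1 + u) $ k * det (mat 1 :: real^'n^'n)"
    by (simp only: cramer_lemma)
  then show ?thesis
    by (simp add: axis_def)
qed

text \<open>An orthogonal change of basis sends the direction of \<open>v\<close> to a coordinate
  axis and preserves determinants and inner products, which reduces the claim to the axis case. The
  length of \<open>v\<close> is moved into \<open>u\<close> first.\<close>

lemma det_identity_add_outer:
  fixes u v :: "real^'n"
  shows "det (mat 1 + outer u v) = 1 + u \<bullet> v"
proof (cases "v = 0")
  case True
  then show ?thesis
    by simp
next
  case False
  define a where "a = v /\<^sub>R norm v"
  have v: "v = norm v *\<^sub>R a" and "norm a = 1"
    using False by (auto simp: a_def)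
  obtain P and k :: 'n where P: "orthogonal_matrix P" "P *v axis k 1 = a"
    using orthogonal_matrix_exists_basis[OF \<open>norm a = 1\<close>] by metis
  let ?Q = "transpose P" and ?u = "norm v *\<^sub>R u"
  have QP: "?Q ** P = mat 1"
    using P(1) by (simp add: orthogonal_matrix_def)
  have Qa: "?Q *v a = axis k 1"
    using P(2) QP by (metis matrix_vector_mul_assoc matrix_vector_mul_lid)
  have ov: "outer u v = outer ?u a"
    by (subst v) (simp add: vec_eq_iff outer_def)
  have "?Q ** (mat 1 + outer u v) ** P = mat 1 + outer (?Q *v ?u) (?Q *v a)"
    by (simp only: ov matrix_add_ldistrib matrix_mul_rid matrix_mult_outer matrix_add_rdistrib
        outer_mult_matrix QP)
  then have "det (?Q ** (mat 1 + outer u v) ** P) = 1 + (?Q *v ?u) $ k"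
    by (simp only: Qa det_identity_add_outer_axis)
  moreover have "det (?Q ** (mat 1 + outer u v) ** P) = det (?Q ** P) * det (mat 1 + outer u v)"
    by (simp add: det_mul)
  moreover have "(?Q *v ?u) $ k = (?Q *v ?u) \<bullet> axis k 1"
    by (simp add: inner_axis)
  moreover have "\<dots> = ?u \<bullet> a"
    unfolding transpose_matrix_vector dot_lmul_matrix P(2) ..
  moreover have "?u \<bullet> a = u \<bullet> v"
    using arg_cong[OF v, of "inner u"] by simp
  ultimately show ?thesis
    by (simp add: QP)
qed

section \<open>Positive definite matrices\<close>

definition positive_definite :: "real^'n^'n \<Rightarrow> bool" where
  "positive_definite A \<longleftrightarrow> transpose A = A \<and> (\<forall>x. x \<noteq> 0 \<longrightarrow> 0 < x \<bullet> (A *v x))"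

lemma symmetric_inner:
  fixes A :: "real^'n^'n"
  assumes "transpose A = A"
  shows "x \<bullet> (A *v y) = (A *v x) \<bullet> y"
  by (metis assms dot_lmul_matrix transpose_matrix_vector)

text \<open>Positivity makes the kernel trivial, which gives the inverse \<open>B\<close>. The form
  of \<open>B\<close> at \<open>x\<close> is the form of \<open>A\<close> at \<open>B *v x\<close>,
  and symmetry passes to \<open>B\<close> because inverses are unique.\<close>

lemma positive_definite_inverse:
  assumes "positive_definite A"
  shows "A ** matrix_inv A = mat 1" and "positive_definite (matrix_inv A)"
proof -
  have sym: "transpose A = A" and pos: "\<And>x. x \<noteq> 0 \<Longrightarrow> 0 < x \<bullet> (A *v x)"
    using assms by (auto simp: positive_definite_def)
  have "\<forall>x. A *v x = 0 \<longrightarrow> x = 0"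
    by (metis inner_zero_right less_irrefl pos)
  then obtain B where "B ** A = mat 1"
    using matrix_left_invertible_ker by blast
  then have AB: "A ** B = mat 1"
    using matrix_left_right_inverse by blast
  then have inv: "matrix_inv A = B"
    by (rule matrix_inv_eqI)
  show "A ** matrix_inv A = mat 1"
    using AB inv by simp
  have A_B: "A *v (B *v x) = x" for x
    by (simp add: matrix_vector_mul_assoc AB)
  have "transpose B ** A = mat 1"
    by (metis AB matrix_transpose_mul sym transpose_mat)
  then have "transpose B = B"
    by (metis AB matrix_mul_assoc matrix_mul_lid matrix_mul_rid)
  moreover have "0 < x \<bullet> (B *v x)" if "x \<noteq> 0" for x
  proof -
    have "B *v x \<noteq> 0"
      using A_B[of x] that by auto
    then have "0 < (B *v x) \<bullet> (A *v (B *v x))"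
      by (rule pos)
    then show ?thesis
      by (simp add: A_B inner_commute)
  qed
  ultimately show "positive_definite (matrix_inv A)"
    by (simp add: inv positive_definite_def)
qed

lemma positive_definite_nonneg:
  assumes "positive_definite A"
  shows "0 \<le> x \<bullet> (A *v x)"
  using assms by (cases "x = 0") (auto simp: positive_definite_def less_imp_le)

lemma positive_definite_add_outer:
  assumes "positive_definite A"
  shows "positive_definite (A + outer v v)"
proof -
  have "transpose (A + outer v v) = transpose A + transpose (outer v v)"
    by (simp add: vec_eq_iff transpose_def)
  moreover have "x \<bullet> ((A + outer v v) *v x) = x \<bullet> (A *v x) + (v \<bullet> x)\<^sup>2" for x
    by (simp add: matrix_vector_mult_add_rdistrib outer_mult_vec inner_add_right
        power2_eq_square inner_commute)
  ultimately show ?thesis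
    using assms by (simp add: positive_definite_def transpose_outer add_pos_nonneg)
qed

lemma positive_definite_scalar:
  assumes "c > 0"
  shows "positive_definite (c *\<^sub>R mat 1)"
  using assms by (simp add: positive_definite_def transpose_scalar flip: scaleR_matrix_vector_assoc)

text \<open>The claimed inverse is verified by applying the product of the two matrices to an
  arbitrary vector \<open>x\<close>.\<close>

lemma sherman_morrison:
  fixes v :: "real^'n"
  assumes "positive_definite A"
  defines "w \<equiv> matrix_inv A *v v"
  shows "matrix_inv (A + outer v v) = matrix_inv A - (1 / (1 + v \<bullet> w)) *\<^sub>R outer w w"
proof (rule matrix_inv_eqI)
  let ?B = "matrix_inv A" and ?k = "1 / (1 + v \<bullet> w)"
  have A_B: "A *v (?B *v x) = x" for x
    by (simp add: matrix_vector_mul_assoc positive_definite_inverse(1) assms)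
  have pd: "positive_definite ?B"
    using assms positive_definite_inverse by blast
  have vB: "v \<bullet> (?B *v x) = w \<bullet> x" for x
    using pd by (simp add: w_def symmetric_inner positive_definite_def)
  have "1 + v \<bullet> w > 0"
    using positive_definite_nonneg[OF pd, of v] by (simp add: w_def)
  \<comment> \<open>This is the scalar that multiplies \<open>(w \<bullet> x) *\<^sub>R v\<close> in
    the product. The choice of \<open>?k\<close> makes it vanish, so that only \<open>x\<close>
    remains.\<close>
  then have k: "1 - ?k - ?k * (v \<bullet> w) = 0"
    by (simp add: field_simps)
  have "((A + outer v v) ** (?B - ?k *\<^sub>R outer w w)) *v x = mat 1 *v x" for x
  proof -
    have "(?B - ?k *\<^sub>R outer w w) *v x = ?B *v x - (?k * (w \<bullet> x)) *\<^sub>R w"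
      by (simp add: matrix_vector_mult_diff_rdistrib outer_mult_vec flip: scaleR_matrix_vector_assoc)
    moreover have "(A + outer v v) *v (?B *v x - (?k * (w \<bullet> x)) *\<^sub>R w) =
        x + ((1 - ?k - ?k * (v \<bullet> w)) * (w \<bullet> x)) *\<^sub>R v"
      by (simp add: matrix_vector_mult_add_rdistrib matrix_vector_mult_diff_distrib
          matrix_vector_mult_scaleR outer_mult_vec inner_diff_right A_B vB w_def[symmetric]
          A_B[of v, folded w_def] scaleR_left_diff_distrib algebra_simps)
    ultimately show ?thesis
      unfolding k by (simp flip: matrix_vector_mul_assoc)
  qed
  then show "(A + outer v v) ** (?B - ?k *\<^sub>R outer w w) = mat 1"
    by (subst matrix_eq) blast
qed

text \<open>Factoring out \<open>A\<close> on the left leaves a rank-one perturbation of the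
  identity, whose determinant is known.\<close>

lemma det_add_outer:
  assumes "positive_definite A"
  shows "det (A + outer v v) = det A * (1 + v \<bullet> (matrix_inv A *v v))"
proof -
  have "A + outer v v = A ** (mat 1 + outer (matrix_inv A *v v) v)"
    by (simp add: matrix_add_ldistrib matrix_mult_outer matrix_vector_mul_assoc
        positive_definite_inverse(1) assms)
  then show ?thesis
    by (simp add: det_mul det_identity_add_outer inner_commute)
qed

text \<open>By Sherman-Morrison the form loses a square divided by \<open>1 + v \<bullet> w\<close>,
  which is at least 1.\<close>

lemma inverse_quadratic_form_add_outer_le:
  assumes "positive_definite A"
  shows "x \<bullet> (matrix_inv (A + outer v v) *v x) \<le> x \<bullet> (matrix_inv A *v x)"
proof -
  define w where "w = matrix_inv A *v v"
  have "0 \<le> v \<bullet> w"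
    unfolding w_def using assms positive_definite_inverse(2) positive_definite_nonneg by blast
  moreover have "x \<bullet> (matrix_inv (A + outer v v) *v x) =
      x \<bullet> (matrix_inv A *v x) - (w \<bullet> x)\<^sup>2 / (1 + v \<bullet> w)"
    unfolding sherman_morrison[OF assms] w_def[symmetric]
    by (simp add: matrix_vector_mult_diff_rdistrib outer_mult_vec inner_diff_right
        power2_eq_square inner_commute flip: scaleR_matrix_vector_assoc)
  ultimately show ?thesis
    by simp
qed

text \<open>The trace drops by \<open>(w \<bullet> w) / (1 + v \<bullet> w)\<close>. Here
  \<open>w\<close> is nonzero because \<open>v \<bullet> w\<close> is the inverse form at the
  nonzero vector \<open>v\<close>.\<close>

lemma trace_inverse_add_outer_less:
  assumes "positive_definite A" and "v \<noteq> 0"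
  shows "trace (matrix_inv (A + outer v v)) < trace (matrix_inv A)"
proof -
  define w where "w = matrix_inv A *v v"
  have "0 < v \<bullet> w"
    unfolding w_def using assms positive_definite_inverse(2) positive_definite_def by blast
  then have "w \<noteq> 0"
    by auto
  moreover have "trace (matrix_inv (A + outer v v)) = trace (matrix_inv A) - (w \<bullet> w) / (1 + v \<bullet> w)"
    unfolding sherman_morrison[OF assms(1)] w_def[symmetric]
    by (simp add: trace_sub trace_scaleR trace_outer)
  ultimately show ?thesis
    using \<open>0 < v \<bullet> w\<close> by simp
qed

section \<open>The largest eigenvalue of a symmetric matrix\<close>

text \<open>Near 0 the linear term dominates, so a nonzero \<open>a\<close> would make the
  expression negative at a small \<open>t\<close> of opposite sign.\<close>

lemma nonneg_linear_quadratic_imp_zero: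
  fixes a b :: real
  assumes "\<And>t. 0 \<le> t * a + t\<^sup>2 * b"
  shows "a = 0"
proof (rule ccontr)
  assume "a \<noteq> 0"
  \<comment> \<open>Any positive \<open>d\<close> above \<open>b\<close> works: at
    \<open>t = - a / d\<close> the expression equals
    \<open>a\<^sup>2 * (b - d) / d\<^sup>2\<close>.\<close>
  define d where "d = \<bar>b\<bar> + 1"
  have "d > 0" "b < d"
    by (auto simp: d_def)
  have "0 \<le> (- a / d) * a + (- a / d)\<^sup>2 * b"
    by (rule assms)
  also have "\<dots> = a\<^sup>2 * (b - d) / d\<^sup>2"
    using \<open>d > 0\<close> by (simp add: field_simps power2_eq_square)
  also have "\<dots> < 0"
    using \<open>a \<noteq> 0\<close> \<open>d > 0\<close> \<open>b < d\<close> by (simp add: divide_less_0_iff mult_less_0_iff)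
  finally show False
    by simp
qed

text \<open>If the quadratic form takes its maximum \<open>l\<close> on the unit sphere at \<open>x\<close>, the form of
  \<open>l I - A\<close> is nonnegative and vanishes at \<open>x\<close>, so its derivative there is zero and \<open>x\<close> is an
  eigenvector.\<close>

lemma lambda_max_rayleigh:
  fixes A :: "real^'n^'n"
  assumes sym: "transpose A = A"
  obtains x where "norm x = 1" "x \<bullet> (A *v x) = lambda_max A"
    "\<And>y. y \<bullet> (A *v y) \<le> lambda_max A * (y \<bullet> y)"
proof -
  have "continuous_on (sphere 0 1) (\<lambda>x. x \<bullet> (A *v x))"
    by (intro continuous_intros)
  moreover have "sphere 0 1 \<noteq> ({} :: (real^'n) set)"
    by simp
  ultimately obtain x where x: "norm x = 1"
    and max: "\<And>y. norm y = 1 \<Longrightarrow> y \<bullet> (A *v y) \<le> x \<bullet> (A *v x)"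
    using continuous_attains_sup[of "sphere (0 :: real^'n) 1" "\<lambda>x. x \<bullet> (A *v x)"] by auto
  define l where "l = x \<bullet> (A *v x)"
  have le: "y \<bullet> (A *v y) \<le> l * (y \<bullet> y)" for y
  proof (cases "y = 0")
    case False
    then have "(y /\<^sub>R norm y) \<bullet> (A *v (y /\<^sub>R norm y)) \<le> l"
      unfolding l_def by (intro max) simp
    moreover have "(y /\<^sub>R norm y) \<bullet> (A *v (y /\<^sub>R norm y)) = (y \<bullet> (A *v y)) / (norm y)\<^sup>2"
      by (simp add: matrix_vector_mult_scaleR power2_eq_square divide_inverse)
    ultimately show ?thesis
      using False by (simp add: divide_le_eq dot_square_norm)
  qed simp
  have "y \<bullet> (l *\<^sub>R x - A *v x) = 0" for y
  proof -
    \<comment> \<open>The left-hand side is the coefficient of \<open>t\<close> when the form of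
      \<open>l I - A\<close> is expanded at \<open>x + t y\<close>; the constant term is 0.\<close>
    have "2 * (y \<bullet> (l *\<^sub>R x - A *v x)) = 0"
    proof (rule nonneg_linear_quadratic_imp_zero)
      fix t :: real
      have "(x + t *\<^sub>R y) \<bullet> (A *v (x + t *\<^sub>R y)) =
          l + 2 * t * (y \<bullet> (A *v x)) + t\<^sup>2 * (y \<bullet> (A *v y))"
        using symmetric_inner[OF sym, of x y]
        by (simp add: matrix_vector_right_distrib matrix_vector_mult_scaleR inner_add_left
            inner_add_right l_def power2_eq_square inner_commute algebra_simps)
      moreover have "(x + t *\<^sub>R y) \<bullet> (x + t *\<^sub>R y) = 1 + 2 * t * (y \<bullet> x) + t\<^sup>2 * (y \<bullet> y)"
        using x by (simp add: inner_add_left inner_add_right power2_eq_square inner_commute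
            algebra_simps norm_eq_1)
      ultimately have "l + 2 * t * (y \<bullet> (A *v x)) + t\<^sup>2 * (y \<bullet> (A *v y))
          \<le> l * (1 + 2 * t * (y \<bullet> x) + t\<^sup>2 * (y \<bullet> y))"
        using le[of "x + t *\<^sub>R y"] by simp
      then show "0 \<le> t * (2 * (y \<bullet> (l *\<^sub>R x - A *v x)))
          + t\<^sup>2 * (l * (y \<bullet> y) - y \<bullet> (A *v y))"
        by (simp add: inner_diff_right algebra_simps)
    qed
    then show ?thesis
      by simp
  qed
  then have "l *\<^sub>R x - A *v x = 0"
    by (metis inner_eq_zero_iff)
  then have "A *v x = l *\<^sub>R x"
    by simp
  moreover have "x \<noteq> 0"
    using x by auto
  ultimately have "eigenvalue A l"
    unfolding eigenvalue_def by blast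
  \<comment> \<open>Evaluating the Rayleigh bound at an eigenvector shows that no eigenvalue exceeds
    \<open>l\<close>, so the \<open>GREATEST\<close> in \<open>lambda_max\<close> is
    attained.\<close>
  moreover have "m \<le> l" if ev: "eigenvalue A m" for m
  proof -
    from ev obtain z where z: "z \<noteq> 0" "A *v z = m *\<^sub>R z"
      by (auto simp: eigenvalue_def)
    then have "m * (z \<bullet> z) \<le> l * (z \<bullet> z)"
      using le[of z] by simp
    then show ?thesis
      using z(1) by simp
  qed
  ultimately have "lambda_max A = l"
    unfolding lambda_max_def by (intro Greatest_equality)
  then show thesis
    using that x le l_def by simp
qed

text \<open>A unit vector that attains the largest eigenvalue of \<open>A\<close> serves as a test
  vector for \<open>B\<close>.\<close>

lemma lambda_max_mono:
  fixes A B :: "real^'n^'n"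
  assumes "transpose A = A" and "transpose B = B"
    and "\<And>x. x \<bullet> (A *v x) \<le> x \<bullet> (B *v x)"
  shows "lambda_max A \<le> lambda_max B"
proof -
  obtain x where x: "norm x = 1" "x \<bullet> (A *v x) = lambda_max A"
    using lambda_max_rayleigh[OF assms(1)] by metis
  then have "lambda_max A \<le> x \<bullet> (B *v x)"
    using assms(3) by metis
  also have "\<dots> \<le> lambda_max B * (x \<bullet> x)"
    using lambda_max_rayleigh[OF assms(2)] by metis
  finally show ?thesis
    using x(1) by (simp add: norm_eq_1)
qed

section \<open>Information matrices\<close>

text \<open>The noise factor is absorbed into the vectors \<open>q e\<close>. Both the index type of
  events and the dimension are left general, so that single blocks and the stacked matrix are
  instances.\<close>

definition info :: "real \<Rightarrow> ('e \<Rightarrow> real^'n) \<Rightarrow> 'e set \<Rightarrow> real^'n^'n" where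
  "info c q H = c *\<^sub>R mat 1 + (\<Sum>e\<in>H. outer (q e) (q e))"

lemma info_insert:
  assumes "finite H" and "x \<notin> H"
  shows "info c q (insert x H) = info c q H + outer (q x) (q x)"
  using assms by (simp add: info_def algebra_simps)

lemma positive_definite_info:
  assumes "c > 0" and "finite H"
  shows "positive_definite (info c q H)"
  using assms(2)
proof induction
  case empty
  then show ?case
    using assms(1) by (simp add: info_def positive_definite_scalar)
next
  case (insert x H)
  then show ?case
    by (simp add: info_insert positive_definite_add_outer)
qed

text \<open>Starting from a power of \<open>c\<close>, each new event multiplies the determinant by
  a factor at least 1.\<close>

lemma det_info_pos:
  fixes q :: "'e \<Rightarrow> real^'n"
  assumes "c > 0" and "finite H"
  shows "det (info c q H) > 0"
  using assms(2)
proof induction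
  case empty
  have "det (c *\<^sub>R mat 1 :: real^'n^'n) = c ^ CARD('n)"
    by (subst det_diagonal) (auto simp: mat_def)
  then show ?case
    using assms(1) by (simp add: info_def)
next
  case (insert x H)
  have pd: "positive_definite (info c q H)"
    using assms(1) insert.hyps by (simp add: positive_definite_info)
  have "0 \<le> q x \<bullet> (matrix_inv (info c q H) *v q x)"
    using pd by (intro positive_definite_nonneg positive_definite_inverse)
  then show ?case
    using insert by (simp add: info_insert det_add_outer[OF pd])
qed

text \<open>The elements of \<open>W\<close> are added to \<open>V\<close> one at a time, and each
  rank-one update can only lower the inverse form.\<close>

lemma inverse_info_antimono:
  assumes "c > 0" and "finite W" and "V \<subseteq> W"
  shows "x \<bullet> (matrix_inv (info c q W) *v x) \<le> x \<bullet> (matrix_inv (info c q V) *v x)"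
proof -
  have "finite D \<Longrightarrow>
      x \<bullet> (matrix_inv (info c q (V \<union> D)) *v x) \<le> x \<bullet> (matrix_inv (info c q V) *v x)" for D
  proof (induction rule: finite_induct)
    case (insert e D)
    show ?case
    proof (cases "e \<in> V \<union> D")
      case True
      then show ?thesis
        using insert.IH by (simp add: insert_absorb)
    next
      case False
      have "finite (V \<union> D)"
        using assms insert.hyps finite_subset by auto
      then have "x \<bullet> (matrix_inv (info c q (insert e (V \<union> D))) *v x)
          \<le> x \<bullet> (matrix_inv (info c q (V \<union> D)) *v x)"
        using False assms(1)
        by (simp only: info_insert inverse_quadratic_form_add_outer_le positive_definite_info
            not_False_eq_True)
      then show ?thesis
        using insert.IH by simp
    qed
  qed simp
  from this[of W] show ?thesis
    using assms by (simp add: Un_absorb1)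
qed

lemma matrix_inv_inverse_info:
  assumes "c > 0" and "finite H"
  shows "matrix_inv (matrix_inv (info c q H)) = info c q H"
  using positive_definite_inverse(1)[OF positive_definite_info[OF assms]]
  by (metis matrix_inv_eqI matrix_left_right_inverse)

lemma trace_info:
  "trace (info c q H :: real^'n^'n) = c * real CARD('n) + (\<Sum>e\<in>H. q e \<bullet> q e)"
proof (induction H rule: infinite_finite_induct)
  case (insert x H)
  then show ?case
    by (simp add: info_insert trace_add trace_outer)
qed (simp_all add: info_def trace_scaleR trace_I)

lemma minus_ln_det_inverse_info:
  assumes "c > 0" and "finite H"
  shows "- ln (det (matrix_inv (info c q H))) = ln (det (info c q H))"
proof -
  have "det (info c q H) * det (matrix_inv (info c q H)) = 1"
    using positive_definite_inverse(1)[OF positive_definite_info[OF assms]]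
    by (metis det_I det_mul)
  then have "det (matrix_inv (info c q H)) = inverse (det (info c q H))"
    by (metis inverse_unique)
  then show ?thesis
    using det_info_pos[OF assms] by (simp add: ln_inverse)
qed

text \<open>The matrix determinant lemma turns the new event into a positive factor, and the
  logarithm into a summand: the gain of the log-determinant.\<close>

lemma ln_det_info_insert:
  assumes "c > 0" and "finite H" and "x \<notin> H"
  shows "ln (det (info c q (insert x H))) =
    ln (det (info c q H)) + ln (1 + q x \<bullet> (matrix_inv (info c q H) *v q x))"
proof -
  have pd: "positive_definite (info c q H)"
    using assms by (simp add: positive_definite_info)
  have "0 \<le> q x \<bullet> (matrix_inv (info c q H) *v q x)"
    using pd by (intro positive_definite_nonneg positive_definite_inverse)
  then show ?thesis
    using det_info_pos[OF assms(1,2), of q] assms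
    by (simp add: info_insert det_add_outer[OF pd] ln_mult)
qed

section \<open>Set functions\<close>

text \<open>The supremum is a maximum, hence a member of \<open>S\<close>, unless \<open>S\<close>
  is empty; then it is minus infinity.\<close>

lemma Sup_finite_ereal_less_infinity:
  assumes "finite S" and "\<And>s. s \<in> S \<Longrightarrow> s < \<infinity>"
  shows "Sup S < (\<infinity> :: ereal)"
proof (cases "S = {}")
  case False
  then show ?thesis
    using assms by (simp flip: Max_Sup)
qed (simp add: bot_ereal_def)

text \<open>Only finitely many triples \<open>(V, W, x)\<close> exist and each contributes a real
  number, so both suprema stay below infinity.\<close>

lemma finite_weakly_submodular:
  assumes "finite U"
  shows "weakly_submodular h U"
proof -
  \<comment> \<open>The function \<open>F\<close> and the side condition \<open>P\<close> are kept
    general to serve both constants: \<open>P\<close> is the nonzero denominator for the quotient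
    and \<open>True\<close> for the difference.\<close>
  have Sup: "Sup {ereal (F V W x) | V W x. V \<subseteq> W \<and> W \<subseteq> U \<and> x \<in> U - W \<and> P V W x} < \<infinity>"
    (is "Sup ?S < _") for F :: "'a set \<Rightarrow> 'a set \<Rightarrow> 'a \<Rightarrow> real" and P
  proof (rule Sup_finite_ereal_less_infinity)
    have "?S \<subseteq> (\<lambda>(V, W, x). ereal (F V W x)) ` (Pow U \<times> Pow U \<times> U)"
    proof
      fix s
      assume "s \<in> ?S"
      then obtain V W x where "s = ereal (F V W x)" "V \<subseteq> W" "W \<subseteq> U" "x \<in> U"
        by blast
      then show "s \<in> (\<lambda>(V, W, x). ereal (F V W x)) ` (Pow U \<times> Pow U \<times> U)"
        by (intro image_eqI[of _ _ "(V, W, x)"]) simp_all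
    qed
    then show "finite ?S"
      by (rule finite_subset) (use assms in simp)
  next
    fix s
    assume "s \<in> ?S"
    then obtain r where "s = ereal r"
      by blast
    then show "s < \<infinity>"
      by simp
  qed
  from Sup[of _ "\<lambda>V W x. gain h V x \<noteq> 0"] Sup[of _ "\<lambda>V W x. True"] show ?thesis
    unfolding weakly_submodular_def mult_weak_const_def add_weak_const_def by simp
qed

lemma monotone_set_funI:
  assumes "\<And>V x. V \<subseteq> U \<Longrightarrow> x \<in> U - V \<Longrightarrow> h V \<le> h (insert x V)"
  shows "monotone_set_fun h U"
  unfolding monotone_set_fun_def
proof (intro allI impI)
  fix V x
  assume "V \<subseteq> U \<and> x \<in> U"
  then show "h V \<le> h (V \<union> {x})"
    using assms[of V x] by (cases "x \<in> V") (auto simp: insert_absorb)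
qed

text \<open>The gain of \<open>x\<close> is \<open>w x\<close> at every set without
  \<open>x\<close>, so submodularity holds with equality.\<close>

lemma modularI:
  assumes "finite U" and "\<And>V. V \<subseteq> U \<Longrightarrow> h V = w0 + (\<Sum>x\<in>V. w x)"
  shows "modular h U"
proof -
  have gain: "gain h V x = w x" if "V \<subseteq> U" "x \<in> U - V" for V x
    using that assms finite_subset[of V U] by (simp add: gain_def)
  have "submodular h U"
    unfolding submodular_def
  proof (intro allI impI)
    fix V W x
    assume "V \<subseteq> W \<and> W \<subseteq> U \<and> x \<in> U - W"
    then have "V \<subseteq> U" "x \<in> U - V" "W \<subseteq> U" "x \<in> U - W"
      by auto
    then show "gain h W x \<le> gain h V x"
      by (simp only: gain order_refl)
  qed
  then show ?thesis
    unfolding modular_def using assms(2) by blast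
qed

section \<open>The covariance as the inverse of one information matrix\<close>

text \<open>In the sum over index pairs only those in the block of the row \<open>p\<close> survive,
  and they contribute only if the column \<open>q\<close> lies in the same block.\<close>

lemma block_diag_mult:
  "block_diag A ** block_diag B = block_diag (\<lambda>u. A u ** B u)"
proof -
  have "(\<Sum>r\<in>UNIV. (if fst p = fst r then A (fst p) $ snd p $ snd r else 0) *
            (if fst r = fst q then B (fst r) $ snd r $ snd q else 0)) =
        (if fst p = fst q then \<Sum>k\<in>UNIV. A (fst p) $ snd p $ k * B (fst p) $ k $ snd q else 0)"
      (is "?l = ?r") for p q
  proof -
    have "?l = (\<Sum>u\<in>UNIV. \<Sum>k\<in>UNIV. (if fst p = u then A (fst p) $ snd p $ k else 0) *
        (if u = fst q then B u $ k $ snd q else 0))"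
      by (simp add: sum.cartesian_product UNIV_Times_UNIV[symmetric] case_prod_beta
          del: UNIV_Times_UNIV)
    also have "\<dots> = (\<Sum>u\<in>UNIV. if u = fst p then ?r else 0)"
      by (intro sum.cong) auto
    finally show ?thesis
      by simp
  qed
  then show ?thesis
    by (simp add: vec_eq_iff block_diag_def matrix_matrix_mult_def)
qed

lemma block_diag_mat_1: "block_diag (\<lambda>u. mat 1) = mat 1"
  by (auto simp: vec_eq_iff block_diag_def mat_def prod_eq_iff)

text \<open>Dividing by \<open>\<sigma>\<close> makes the outer product carry the factor
  \<open>1 / \<sigma>\<^sup>2\<close> of the covariance.\<close>

definition stacked_feature ::
    "real \<Rightarrow> real \<Rightarrow> 'v event set \<Rightarrow> 'v event \<Rightarrow> real^('v::finite \<times> 'v option)" where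
  "stacked_feature \<sigma> \<omega> UT e = (\<chi> p. feature \<omega> UT (fst p) e $ snd p / \<sigma>)"

text \<open>The constant last coordinate of the posting user's block is \<open>1 / \<sigma>\<close>.
  This is what makes the gains of \<open>f_A\<close> strictly positive.\<close>

lemma stacked_feature_nonzero:
  assumes "\<sigma> > 0"
  shows "stacked_feature \<sigma> \<omega> UT e \<noteq> 0"
proof -
  have "stacked_feature \<sigma> \<omega> UT e $ (user e, None) \<noteq> 0"
    using assms by (simp add: stacked_feature_def feature_def)
  then show ?thesis
    by (metis zero_index)
qed

text \<open>Each event has a nonzero feature vector for a single user, so the rank-one update by the
  stacked feature vector stays inside one diagonal block.\<close>

lemma info_stacked_feature:
  "info c (stacked_feature \<sigma> \<omega> UT) H =
    block_diag (\<lambda>u. info c (\<lambda>e. (1 / \<sigma>) *\<^sub>R feature \<omega> UT u e) H)"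
proof -
  have "stacked_feature \<sigma> \<omega> UT e $ p * stacked_feature \<sigma> \<omega> UT e $ q =
      (if fst p = fst q
       then (1 / \<sigma>) *\<^sub>R feature \<omega> UT (fst p) e $ snd p *
            (1 / \<sigma>) *\<^sub>R feature \<omega> UT (fst p) e $ snd q
       else 0)" for e p q
    by (auto simp: stacked_feature_def feature_def)
  then show ?thesis
    by (auto simp: vec_eq_iff info_def block_diag_def outer_def mat_def prod_eq_iff)
qed

text \<open>Block-diagonal matrices multiply blockwise, so the block diagonal of the inverses is a
  right inverse of the stacked matrix.\<close>

lemma Cov_eq_inverse_info:
  assumes "c > 0" and "finite H"
  shows "Cov c \<sigma> \<omega> UT H = matrix_inv (info c (stacked_feature \<sigma> \<omega> UT) H)"
proof -
  let ?M = "\<lambda>u. info c (\<lambda>e. (1 / \<sigma>) *\<^sub>R feature \<omega> UT u e) H"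
  have "cov_block c \<sigma> \<omega> UT H = (\<lambda>u. matrix_inv (?M u))"
    by (simp add: fun_eq_iff cov_block_def info_def outer_scaleR scaleR_sum_right power2_eq_square)
  moreover have "block_diag ?M ** block_diag (\<lambda>u. matrix_inv (?M u)) = mat 1"
    using assms
    by (simp add: block_diag_mult positive_definite_inverse(1) positive_definite_info
        block_diag_mat_1)
  ultimately show ?thesis
    by (simp add: Cov_def info_stacked_feature matrix_inv_eqI)
qed

theorem theorem4p3:
  fixes UT :: "('v::finite) event set" and c \<sigma> \<omega> T :: real
  assumes "finite UT"
    and "\<And>e. e \<in> UT \<Longrightarrow> 0 \<le> time e \<and> time e < T"
    and "c > 0" and "\<sigma> > 0" and "\<omega> \<ge> 0"
  shows "(\<forall>f \<in> {f_A c \<sigma> \<omega> UT, f_D c \<sigma> \<omega> UT, f_E c \<sigma> \<omega> UT, f_T c \<sigma> \<omega> UT}.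
            monotone_set_fun f UT)
       \<and> (weakly_submodular (f_A c \<sigma> \<omega> UT) UT
            \<and> (\<forall>V x. V \<subseteq> UT \<and> x \<in> UT - V \<longrightarrow> gain (f_A c \<sigma> \<omega> UT) V x \<noteq> 0)
            \<and> weakly_submodular (f_E c \<sigma> \<omega> UT) UT)
       \<and> submodular (f_D c \<sigma> \<omega> UT) UT
       \<and> modular (f_T c \<sigma> \<omega> UT) UT"
proof -
  define q where "q = stacked_feature \<sigma> \<omega> UT"
  let ?M = "info c q"
  let ?s = "\<lambda>V x. q x \<bullet> (matrix_inv (?M V) *v q x)"
  have fin: "finite V" if "V \<subseteq> UT" for V
    using that assms(1) finite_subset by blast
  have Cov: "Cov c \<sigma> \<omega> UT V = matrix_inv (?M V)" if "V \<subseteq> UT" for V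
    using assms(3) fin[OF that] by (simp add: q_def Cov_eq_inverse_info)
  have pd: "positive_definite (?M V)" if "V \<subseteq> UT" for V
    using assms(3) fin[OF that] by (rule positive_definite_info)
  have s_nonneg: "0 \<le> ?s V x" if "V \<subseteq> UT" for V x
    using pd[OF that] by (intro positive_definite_nonneg positive_definite_inverse)
  have A_less: "f_A c \<sigma> \<omega> UT V < f_A c \<sigma> \<omega> UT (insert x V)" if "V \<subseteq> UT" "x \<in> UT - V" for V x
    using that fin[of V] pd[of V] assms(4)
    by (simp add: f_A_def Cov info_insert trace_inverse_add_outer_less stacked_feature_nonzero q_def)
  have D_gain: "f_D c \<sigma> \<omega> UT (insert x V) = f_D c \<sigma> \<omega> UT V + ln (1 + ?s V x)"
    if "V \<subseteq> UT" "x \<in> UT - V" for V x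
    using that fin[of V] assms(3)
    by (simp add: f_D_def Cov minus_ln_det_inverse_info ln_det_info_insert)
  have E_le: "f_E c \<sigma> \<omega> UT V \<le> f_E c \<sigma> \<omega> UT (insert x V)" if "V \<subseteq> UT" "x \<in> UT - V" for V x
  proof -
    \<comment> \<open>Symmetry of the inverses is what the Rayleigh comparison of their largest
      eigenvalues requires.\<close>
    have "transpose (matrix_inv (?M W)) = matrix_inv (?M W)" if "W \<subseteq> UT" for W
      using positive_definite_inverse(2)[OF pd[OF that]] by (simp add: positive_definite_def)
    then have "lambda_max (matrix_inv (?M (insert x V))) \<le> lambda_max (matrix_inv (?M V))"
      using that fin[of V] assms(3) by (intro lambda_max_mono inverse_info_antimono) auto
    then show ?thesis
      using that by (simp add: f_E_def Cov)
  qed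
  have T_eq: "f_T c \<sigma> \<omega> UT V = c * real CARD('v \<times> 'v option) + (\<Sum>e\<in>V. q e \<bullet> q e)"
    if "V \<subseteq> UT" for V
    using that fin[of V] assms(3) by (simp only: f_T_def Cov matrix_inv_inverse_info trace_info)
  have "monotone_set_fun (f_A c \<sigma> \<omega> UT) UT"
    using A_less by (intro monotone_set_funI less_imp_le)
  moreover have "monotone_set_fun (f_D c \<sigma> \<omega> UT) UT"
    using D_gain s_nonneg by (intro monotone_set_funI) simp
  moreover have "monotone_set_fun (f_E c \<sigma> \<omega> UT) UT"
    using E_le by (intro monotone_set_funI)
  moreover have "monotone_set_fun (f_T c \<sigma> \<omega> UT) UT"
  proof (rule monotone_set_funI)
    fix V x
    assume "V \<subseteq> UT" "x \<in> UT - V"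
    then show "f_T c \<sigma> \<omega> UT V \<le> f_T c \<sigma> \<omega> UT (insert x V)"
      using fin[of V] by (simp add: T_eq)
  qed
  \<comment> \<open>Hence no quotient is left out of the multiplicative constant of
    \<open>f_A\<close> for a zero denominator.\<close>
  moreover have "gain (f_A c \<sigma> \<omega> UT) V x \<noteq> 0" if "V \<subseteq> UT" "x \<in> UT - V" for V x
    using A_less[OF that] by (simp add: gain_def)
  moreover have "submodular (f_D c \<sigma> \<omega> UT) UT"
    unfolding submodular_def
  proof (intro allI impI)
    fix V W x
    assume *: "V \<subseteq> W \<and> W \<subseteq> UT \<and> x \<in> UT - W"
    \<comment> \<open>Diminishing returns: the inverse form at the same vector \<open>q x\<close>
      shrinks as the set grows, and the logarithm preserves the order.\<close>
    then have "?s W x \<le> ?s V x"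
      using assms(3) fin[of W] by (intro inverse_info_antimono) auto
    then have "ln (1 + ?s W x) \<le> ln (1 + ?s V x)"
      using s_nonneg[of W x] * by (intro ln_mono) auto
    moreover have "V \<subseteq> UT" "x \<in> UT - V"
      using * by auto
    ultimately show "gain (f_D c \<sigma> \<omega> UT) W x \<le> gain (f_D c \<sigma> \<omega> UT) V x"
      using * D_gain[of V x] D_gain[of W x] by (simp add: gain_def)
  qed
  moreover have "modular (f_T c \<sigma> \<omega> UT) UT"
    using assms(1) T_eq by (rule modularI)
  ultimately show ?thesis
    using finite_weakly_submodular[OF assms(1)] by blast
qed

end
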